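(* Let $(x_n)_{n\ge1}$ be a sequence of points in a Hadamard space $(H,d)$ converging to $x\in H$. Let $b_n$ be the barycenter of $x_1,\dots,x_n$, let $S_n$ be the inductive mean of $x_1,\dots,x_n$, let $\beta_n=\beta_n(x_1,\dots,x_n)$ be the axiomatic mean (of Es-Sahib–Heinich and Navas), and let $c_n$ be any convex mean of $X_n$, where $X_n$ is drawn uniformly from $\{x_1,\dots,x_n\}$. Then $b_n\to x$, $S_n\to x$, $\beta_n\to x$ and $c_n\to x$.
   Context: A Hadamard space is a complete metric space $(H,d)$ such that for all $x,y\in H$ there is $m\in H$ with $d(z,m)^2\le\frac12 d(z,x)^2+\frac12 d(z,y)^2-\frac14 d(x,y)^2$ for all $z\in H$. Any two points $x,y\in H$ are joined by a unique minimal geodesic, i.e. a map $\gamma:[0,1]\to H$ with $\gamma(0)=x$, $\gamma(1)=y$, $d(\gamma(s),\gamma(t))=|t-s|\,d(x,y)$; write $x\oplus_t y=\gamma(t)$. Barycenter: the unique minimizer $b_n=\operatorname{arg\,min}_{z\in H}\frac1n\sum_{k=1}^n d(x_k,z)^2$. Inductive mean: $S_1=x_1$, $S_{n+1}=S_n\oplus_{\frac1{n+1}}x_{n+1}$. Axiomatic mean: a family of maps $\beta_n:H^n\to H$, $n\ge1$, recursively satisfying (1) $\beta_n(x,\dots,x)=x$ for all $x\in H$; (2) $d(\beta_n(x_1,\dots,x_n),\beta_n(y_1,\dots,y_n))\le\frac1n\sum_{k=1}^n d(x_k,y_k)$ for all $x_i,y_j\in H$; (3) $\beta_n(x_1,\dots,x_n)=\beta_n(\hat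 x_1,\dots,\hat x_n)$, where $\hat x_i=\beta_{n-1}(x_1,\dots,x_{i-1},x_{i+1},\dots,x_n)$ (for the recursive steps). Convex mean: given an $H$-valued random variable $X$ with $\mathbb{E}(d(X,y))<\infty$ for some $y\in H$, a point $c\in H$ is a convex mean of $X$ if $\varphi(c)\le\mathbb{E}(\varphi(X))$ for all convex, Lipschitz continuous $\varphi:H\to\mathbb{R}$ (convex meaning convex along minimal geodesics). "Uniformly from $\{x_1,\dots,x_n\}$" means each index is selected with probability $1/n$. *)

theory Defs
  imports "HOL-Probability.Probability"
begin

class hadamard_space = complete_space +
  assumes hadamard_midpoint:
    "\<exists>m. \<forall>z. (dist z m)\<^sup>2 \<le> 1/2 * (dist z x)\<^sup>2 + 1/2 * (dist z y)\<^sup>2 - 1/4 * (dist x y)\<^sup>2"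

(* Only the values of g on the unit interval matter. *)
definition minimal_geodesic :: "(real \<Rightarrow> 'a::metric_space) \<Rightarrow> 'a \<Rightarrow> 'a \<Rightarrow> bool" where
  "minimal_geodesic g x y \<longleftrightarrow>
     g 0 = x \<and> g 1 = y \<and>
     (\<forall>s\<in>{0..1}. \<forall>t\<in>{0..1}. dist (g s) (g t) = \<bar>t - s\<bar> * dist x y)"

(* The description is over points rather than geodesics because a geodesic, taken as a
   total function on the reals, is determined only on the unit interval. *)
definition geodesic_point :: "'a::hadamard_space \<Rightarrow> real \<Rightarrow> 'a \<Rightarrow> 'a" where
  "geodesic_point x t y = (THE z. \<exists>g. minimal_geodesic g x y \<and> z = g t)"

(* Sequences are indexed from 1; the value of a sequence at 0 is never used. *)
definition barycenter :: "(nat \<Rightarrow> 'a::hadamard_space) \<Rightarrow> nat \<Rightarrow> 'a" where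
  "barycenter x n =
     (THE b. is_arg_min (\<lambda>z. 1 / real n * (\<Sum>k=1..n. (dist (x k) z)\<^sup>2)) (\<lambda>z. z \<in> UNIV) b)"

fun inductive_mean :: "(nat \<Rightarrow> 'a::hadamard_space) \<Rightarrow> nat \<Rightarrow> 'a" where
  "inductive_mean x 0 = undefined"
| "inductive_mean x (Suc 0) = x 1"
| "inductive_mean x (Suc (Suc n)) =
     geodesic_point (inductive_mean x (Suc n)) (1 / real (Suc (Suc n))) (x (Suc (Suc n)))"

(* An n-tuple is a list of length n, so a family of maps, one for each n \<ge> 1, is a single
   function on nonempty lists.  The recursive condition starts at n = 2, the first n for
   which the map for n - 1 exists; there it only says that the map for n = 2 is symmetric,
   which already follows from the other two conditions. *)
definition axiomatic_mean :: "('a::hadamard_space list \<Rightarrow> 'a) \<Rightarrow> bool" where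
  "axiomatic_mean \<beta> \<longleftrightarrow>
     (\<forall>n\<ge>1. \<forall>x. \<beta> (replicate n x) = x) \<and>
     (\<forall>n\<ge>1. \<forall>xs ys. length xs = n \<and> length ys = n \<longrightarrow>
        dist (\<beta> xs) (\<beta> ys) \<le> 1 / real n * (\<Sum>k<n. dist (xs ! k) (ys ! k))) \<and>
     (\<forall>n\<ge>2. \<forall>xs. length xs = n \<longrightarrow>
        \<beta> xs = \<beta> (map (\<lambda>i. \<beta> (take i xs @ drop (Suc i) xs)) [0..<n]))"

definition geodesically_convex :: "('a::metric_space \<Rightarrow> real) \<Rightarrow> bool" where
  "geodesically_convex \<phi> \<longleftrightarrow>
     (\<forall>g x y. minimal_geodesic g x y \<longrightarrow> convex_on {0..1} (\<phi> \<circ> g))"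

definition convex_mean :: "'b measure \<Rightarrow> ('b \<Rightarrow> 'a::hadamard_space) \<Rightarrow> 'a \<Rightarrow> bool" where
  "convex_mean M X c \<longleftrightarrow>
     prob_space M \<and> X \<in> borel_measurable M \<and>
     (\<exists>y. integrable M (\<lambda>\<omega>. dist (X \<omega>) y)) \<and>
     (\<forall>\<phi>. geodesically_convex \<phi> \<and> (\<exists>L. L-lipschitz_on UNIV \<phi>) \<longrightarrow>
        \<phi> c \<le> prob_space.expectation M (\<lambda>\<omega>. \<phi> (X \<omega>)))"

(* The law is the image of the uniform distribution on the indices, so a point occurring
   several times among x 1, ..., x n is weighted by its multiplicity. *)
definition drawn_uniformly ::
    "'b measure \<Rightarrow> ('b \<Rightarrow> 'a::hadamard_space) \<Rightarrow> (nat \<Rightarrow> 'a) \<Rightarrow> nat \<Rightarrow> bool" where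
  "drawn_uniformly M X x n \<longleftrightarrow>
     prob_space M \<and> X \<in> borel_measurable M \<and>
     distr M borel X = distr (measure_pmf (pmf_of_set {1..n})) borel x"

end

theory Submission
  imports Defs
begin

text \<open>
  The distance of each mean to the limit \<open>l\<close> is controlled by Cesaro averages of the numbers
  \<open>dist (x k) l\<close> or of their squares, and these averages tend to zero because
  \<open>dist (x k) l \<longlonglongrightarrow> 0\<close>.

  For the axiomatic mean, the bound \<open>dist (\<beta> (x\<^sub>1, \<dots>, x\<^sub>n)) l \<le> 1/n * (\<Sum>k. dist (x\<^sub>k) l)\<close> is the
  contraction property applied to the constant tuple \<open>(l, \<dots>, l)\<close>.  For a convex mean it is the
  defining inequality for the test function \<open>\<lambda>z. dist z l\<close>, and for the inductive mean it
  follows by induction from the inequality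
  \<open>dist z (x \<oplus>\<^sub>t y) \<le> (1 - t) * dist z x + t * dist z y\<close>; both rest on the convexity of the
  distance to a point.  For the barycenter, minimality compares the mean squared distance to
  \<open>b\<^sub>n\<close> with that to \<open>l\<close>, so that \<open>(dist b\<^sub>n l)\<^sup>2\<close> is at most four times the average of the
  squares \<open>(dist (x\<^sub>k) l)\<^sup>2\<close>.

  It remains to see that these objects exist and that the distance is convex.
  A continuous function that gains the term \<open>- (dist p q)\<^sup>2 / 4\<close> at midpoints
  has a unique minimizer \<open>w\<close> (lemma \<open>strongly_midconvex_ex_minimizer\<close>) and satisfies
  the variance inequality \<open>F w + (dist w z)\<^sup>2 \<le> F z\<close> (lemma \<open>variance_inequality\<close>).
  The mean squared distance to finitely many points is such a function, which gives the barycenter.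
  The weighted sum \<open>(1 - t) * (dist x z)\<^sup>2 + t * (dist y z)\<^sup>2\<close> is another one; its minimizer is the
  point \<open>x \<oplus>\<^sub>t y\<close>, and its variance inequality yields the convexity of the distance.
\<close>

section \<open>Strongly convex functions\<close>

definition hadamard_mid :: "'a::hadamard_space \<Rightarrow> 'a \<Rightarrow> 'a" where
  "hadamard_mid x y = (SOME m. \<forall>z. (dist z m)\<^sup>2 \<le>
      1/2 * (dist z x)\<^sup>2 + 1/2 * (dist z y)\<^sup>2 - 1/4 * (dist x y)\<^sup>2)"

lemma hadamard_mid_inequality:
  "(dist z (hadamard_mid x y))\<^sup>2 \<le>
     1/2 * (dist z x)\<^sup>2 + 1/2 * (dist z y)\<^sup>2 - 1/4 * (dist x y)\<^sup>2"
  using someI_ex[OF hadamard_midpoint[of x y]] unfolding hadamard_mid_def by blast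

lemma dist_hadamard_mid:
  "dist x (hadamard_mid x y) = dist x y / 2"
  "dist y (hadamard_mid x y) = dist x y / 2"
proof -
  let ?m = "hadamard_mid x y"
  have "(dist x ?m)\<^sup>2 \<le> (dist x y / 2)\<^sup>2" "(dist y ?m)\<^sup>2 \<le> (dist x y / 2)\<^sup>2"
    using hadamard_mid_inequality[of x x y] hadamard_mid_inequality[of y x y]
    by (auto simp: power_divide dist_commute)
  then have "dist x ?m \<le> dist x y / 2" "dist y ?m \<le> dist x y / 2"
    by (auto intro: power2_le_imp_le)
  moreover have "dist x y \<le> dist x ?m + dist y ?m"
    by (metis dist_triangle dist_commute)
  ultimately show "dist x ?m = dist x y / 2" "dist y ?m = dist x y / 2"
    by auto
qed

text \<open>
  The constant \<open>1/4\<close> is that of the squared distance to a point, so the condition is inherited by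
  all weighted averages of squared distances.
\<close>

definition strongly_midconvex :: "('a::hadamard_space \<Rightarrow> real) \<Rightarrow> bool" where
  "strongly_midconvex F \<longleftrightarrow>
     (\<forall>p q. F (hadamard_mid p q) \<le> F p / 2 + F q / 2 - (dist p q)\<^sup>2 / 4)"

text \<open>
  The quadratic gain at midpoints makes every minimizing sequence Cauchy: the midpoint of two
  almost minimal points would otherwise fall below the infimum.
\<close>

lemma strongly_midconvex_ex_minimizer:
  fixes F :: "'a::hadamard_space \<Rightarrow> real"
  assumes F: "strongly_midconvex F" and cont: "continuous_on UNIV F" and nonneg: "\<And>z. 0 \<le> F z"
  obtains w where "\<And>z. F w \<le> F z"
proof -
  define I where "I = (INF z. F z)"
  have bdd: "bdd_below (range F)"
    using nonneg by (auto intro: bdd_belowI[of _ 0])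
  have I_le: "I \<le> F z" for z
    unfolding I_def by (rule cINF_lower[OF bdd]) simp
  have "\<exists>z. F z < I + inverse (real (Suc n))" for n
  proof -
    have "(INF z. F z) < I + inverse (real (Suc n))" by (simp add: I_def)
    then show ?thesis using cINF_less_iff[OF _ bdd] by blast
  qed
  then obtain u where u: "\<And>n. F (u n) < I + inverse (real (Suc n))" by metis
  have dist_u: "(dist (u m) (u n))\<^sup>2 < 4 * inverse (real (Suc N))" if "N \<le> m" "N \<le> n" for m n N
  proof -
    have inv_le: "inverse (real (Suc k)) \<le> inverse (real (Suc N))" if "N \<le> k" for k
      using that by simp
    have "I \<le> F (u m) / 2 + F (u n) / 2 - (dist (u m) (u n))\<^sup>2 / 4"
      using F I_le order_trans unfolding strongly_midconvex_def by blast
    then show ?thesis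
      using u[of m] u[of n] inv_le[OF that(1)] inv_le[OF that(2)]
      by linarith
  qed
  have "Cauchy u"
  proof (rule metric_CauchyI)
    fix e :: real assume e: "0 < e"
    then have "0 < e\<^sup>2 / 4" by simp
    then obtain N where N: "inverse (real (Suc N)) < e\<^sup>2 / 4"
      using reals_Archimedean by blast
    have "dist (u m) (u n) < e" if "N \<le> m" "N \<le> n" for m n
    proof (rule power2_less_imp_less)
      show "(dist (u m) (u n))\<^sup>2 < e\<^sup>2" using dist_u[OF that] N by linarith
    qed (use e in simp)
    then show "\<exists>M. \<forall>m\<ge>M. \<forall>n\<ge>M. dist (u m) (u n) < e" by blast
  qed
  then obtain w where w: "u \<longlonglongrightarrow> w"
    using Cauchy_convergent_iff convergent_def by blast
  have "(\<lambda>n. F (u n)) \<longlonglongrightarrow> F w"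
    using continuous_on_tendsto_compose[OF cont w] by simp
  moreover have "(\<lambda>n. I + inverse (real (Suc n))) \<longlonglongrightarrow> I + 0"
    by (intro tendsto_intros LIMSEQ_inverse_real_of_nat)
  ultimately have "F w \<le> I + 0"
    using u by (intro LIMSEQ_le) (auto intro: less_imp_le)
  then show thesis using that[of w] I_le order_trans by fastforce
qed

text \<open>
  A single use of the midpoint condition only gives the constant \<open>1/2\<close> in front of the squared
  distance.  Feeding the bound obtained for the midpoint of \<open>w\<close> and \<open>z\<close> back into the midpoint
  condition halves the defect from the optimal constant \<open>1\<close>.
\<close>

lemma variance_inequality:
  fixes F :: "'a::hadamard_space \<Rightarrow> real"
  assumes F: "strongly_midconvex F" and min: "\<And>z. F w \<le> F z"
  shows "F w + (dist w z)\<^sup>2 \<le> F z"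
proof -
  have approx: "F w + (1 - (1/2)^k) * (dist w z)\<^sup>2 \<le> F z" for k z
  proof (induction k arbitrary: z)
    case 0
    then show ?case using min by simp
  next
    case (Suc k)
    let ?m = "hadamard_mid w z"
    define c where "c = (1/2::real)^k"
    have "F w + (1 - c) * ((dist w z)\<^sup>2 / 4) \<le> F ?m"
      using Suc[of ?m] unfolding c_def by (simp add: dist_hadamard_mid power_divide)
    moreover have "F ?m \<le> F w / 2 + F z / 2 - (dist w z)\<^sup>2 / 4"
      using F unfolding strongly_midconvex_def by blast
    ultimately have "F w + (1 - c / 2) * (dist w z)\<^sup>2 \<le> F z"
      by (simp add: algebra_simps add_divide_distrib diff_divide_distrib)
    then show ?case unfolding c_def by simp
  qed
  have "(\<lambda>k. F w + (1 - (1/2)^k) * (dist w z)\<^sup>2) \<longlonglongrightarrow> F w + (1 - 0) * (dist w z)\<^sup>2"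
    by (intro tendsto_intros LIMSEQ_realpow_zero) auto
  then show ?thesis
    using approx by (intro LIMSEQ_le_const2[where X = "\<lambda>k. F w + (1 - (1/2)^k) * (dist w z)\<^sup>2"]) auto
qed

section \<open>Points on geodesics\<close>

definition weighted_sq_dist :: "real \<Rightarrow> 'a::metric_space \<Rightarrow> 'a \<Rightarrow> 'a \<Rightarrow> real" where
  "weighted_sq_dist t x y z = (1 - t) * (dist x z)\<^sup>2 + t * (dist y z)\<^sup>2"

lemma strongly_midconvex_weighted_sq_dist:
  assumes "0 \<le> t" "t \<le> 1"
  shows "strongly_midconvex (weighted_sq_dist t x y)"
  unfolding strongly_midconvex_def
proof (intro allI)
  fix p q :: 'a
  have "(1 - t) * (dist x (hadamard_mid p q))\<^sup>2 \<le>
      (1 - t) * (1/2 * (dist x p)\<^sup>2 + 1/2 * (dist x q)\<^sup>2 - 1/4 * (dist p q)\<^sup>2)"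
    using assms by (intro mult_left_mono hadamard_mid_inequality) auto
  moreover have "t * (dist y (hadamard_mid p q))\<^sup>2 \<le>
      t * (1/2 * (dist y p)\<^sup>2 + 1/2 * (dist y q)\<^sup>2 - 1/4 * (dist p q)\<^sup>2)"
    using assms by (intro mult_left_mono hadamard_mid_inequality) auto
  ultimately show "weighted_sq_dist t x y (hadamard_mid p q) \<le>
      weighted_sq_dist t x y p / 2 + weighted_sq_dist t x y q / 2 - (dist p q)\<^sup>2 / 4"
    unfolding weighted_sq_dist_def by argo
qed

text \<open>
  For \<open>t\<close> in the unit interval, \<open>weighted_sq_dist t x y\<close> never falls below \<open>t * (1 - t) * (dist x y)\<^sup>2\<close>, and attains
  this value exactly where a point at parameter \<open>t\<close> of a geodesic has to lie.
\<close>

lemma weighted_sq_dist_ge: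
  assumes "0 \<le> t" "t \<le> 1"
  shows "t * (1 - t) * (dist x y)\<^sup>2 + ((1 - t) * dist x z - t * dist y z)\<^sup>2 \<le>
      weighted_sq_dist t x y z"
proof -
  have "dist x y \<le> dist x z + dist y z" by (metis dist_triangle dist_commute)
  then have "(dist x y)\<^sup>2 \<le> (dist x z + dist y z)\<^sup>2" by (intro power_mono) auto
  then have "t * (1 - t) * (dist x y)\<^sup>2 \<le> t * (1 - t) * (dist x z + dist y z)\<^sup>2"
    using assms by (intro mult_left_mono) auto
  also have "\<dots> + ((1 - t) * dist x z - t * dist y z)\<^sup>2 = weighted_sq_dist t x y z"
    unfolding weighted_sq_dist_def by algebra
  finally show ?thesis by simp
qed

lemma weighted_sq_dist_eq:
  assumes "dist x z = t * dist x y" "dist y z = (1 - t) * dist x y"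
  shows "weighted_sq_dist t x y z = t * (1 - t) * (dist x y)\<^sup>2"
  unfolding weighted_sq_dist_def assms by algebra

text \<open>
  Bisection: the point wanted at parameter \<open>t\<close> between \<open>x\<close> and \<open>y\<close> is, after rescaling the
  parameter, a point between \<open>x\<close> or \<open>y\<close> and their midpoint.  Each step halves both the length
  of the segment and the error.
\<close>

lemma ex_approximate_geodesic_point:
  fixes x y :: "'a::hadamard_space"
  assumes "0 \<le> t" "t \<le> 1"
  shows "\<exists>p. dist x p \<le> t * dist x y + dist x y / 2^k \<and>
             dist y p \<le> (1 - t) * dist x y + dist x y / 2^k"
  using assms
proof (induction k arbitrary: x y t)
  case 0
  then have "0 \<le> t * dist x y" "0 \<le> (1 - t) * dist x y" by auto
  then show ?case by (intro exI[of _ x]) (auto simp: dist_commute)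
next
  case (Suc k)
  have near_first: "\<exists>p. dist x p \<le> t * dist x y + dist x y / 2^Suc k \<and>
             dist y p \<le> (1 - t) * dist x y + dist x y / 2^Suc k"
    if t: "0 \<le> t" "t \<le> 1/2" for x y :: 'a and t
  proof -
    let ?m = "hadamard_mid x y"
    obtain p where p: "dist x p \<le> 2 * t * dist x ?m + dist x ?m / 2^k"
        "dist ?m p \<le> (1 - 2 * t) * dist x ?m + dist x ?m / 2^k"
      using Suc.IH[of "2 * t" x ?m] t by auto
    have "dist y p \<le> dist y ?m + dist ?m p" by (rule dist_triangle)
    then have "dist x p \<le> t * dist x y + dist x y / 2^Suc k"
        "dist y p \<le> (1 - t) * dist x y + dist x y / 2^Suc k"
      using p by (auto simp: dist_hadamard_mid algebra_simps diff_divide_distrib)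
    then show ?thesis by blast
  qed
  show ?case
  proof (cases "t \<le> 1/2")
    case True
    then show ?thesis using near_first[of t x y] Suc.prems by blast
  next
    case False
    then show ?thesis using near_first[of "1 - t" y x] Suc.prems by (auto simp: dist_commute)
  qed
qed

lemma ex_point_between:
  fixes x y :: "'a::hadamard_space"
  assumes t: "0 \<le> t" "t \<le> 1"
  obtains p where "dist x p = t * dist x y" "dist y p = (1 - t) * dist x y"
proof -
  let ?F = "weighted_sq_dist t x y" and ?D = "dist x y"
  have "continuous_on UNIV ?F"
    unfolding weighted_sq_dist_def by (intro continuous_intros)
  moreover have "0 \<le> ?F z" for z
    using t unfolding weighted_sq_dist_def by auto
  ultimately obtain w where w: "\<And>z. ?F w \<le> ?F z"
    using strongly_midconvex_ex_minimizer[OF strongly_midconvex_weighted_sq_dist[OF t]] by blast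
  have "?F w \<le> (1 - t) * (t * ?D + ?D * (1/2)^k)\<^sup>2 + t * ((1 - t) * ?D + ?D * (1/2)^k)\<^sup>2" for k
  proof -
    have halves: "?D / 2^k = ?D * (1/2)^k" by (simp add: power_one_over)
    obtain p where p: "dist x p \<le> t * ?D + ?D * (1/2)^k" "dist y p \<le> (1 - t) * ?D + ?D * (1/2)^k"
      using ex_approximate_geodesic_point[OF t, of x y k] unfolding halves by blast
    have "?F w \<le> ?F p" by (rule w)
    also have "\<dots> \<le> (1 - t) * (t * ?D + ?D * (1/2)^k)\<^sup>2 + t * ((1 - t) * ?D + ?D * (1/2)^k)\<^sup>2"
      unfolding weighted_sq_dist_def
      using t p by (intro add_mono mult_left_mono power_mono) auto
    finally show ?thesis .
  qed
  moreover have "(\<lambda>k. (1 - t) * (t * ?D + ?D * (1/2)^k)\<^sup>2 + t * ((1 - t) * ?D + ?D * (1/2)^k)\<^sup>2)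
      \<longlonglongrightarrow> (1 - t) * (t * ?D + ?D * 0)\<^sup>2 + t * ((1 - t) * ?D + ?D * 0)\<^sup>2"
    by (intro tendsto_intros LIMSEQ_realpow_zero) auto
  ultimately have "?F w \<le> (1 - t) * (t * ?D + ?D * 0)\<^sup>2 + t * ((1 - t) * ?D + ?D * 0)\<^sup>2"
    by (intro LIMSEQ_le_const) auto
  also have "\<dots> = t * (1 - t) * ?D\<^sup>2" by algebra
  finally have F_w: "?F w \<le> t * (1 - t) * ?D\<^sup>2" .
  have "((1 - t) * dist x w - t * dist y w)\<^sup>2 \<le> 0"
    using weighted_sq_dist_ge[OF t, of x y w] F_w by linarith
  then have balanced: "(1 - t) * dist x w = t * dist y w" by simp
  \<comment> \<open>With \<open>s = dist x w + dist y w\<close>, balance means \<open>dist x w = t * s\<close> and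
    \<open>dist y w = (1 - t) * s\<close>; it remains to compare \<open>s\<close> with \<open>dist x y\<close>, for which the
    factor \<open>t * (1 - t)\<close> must not vanish.  For \<open>t = 0\<close> and \<open>t = 1\<close> the endpoints serve.\<close>
  show thesis
  proof (cases "t = 0 \<or> t = 1")
    case True
    then show ?thesis using that[of x] that[of y] by (auto simp: dist_commute)
  next
    case False
    define s where "s = dist x w + dist y w"
    have xw: "dist x w = t * s" and yw: "dist y w = (1 - t) * s"
      using balanced unfolding s_def by (auto simp: algebra_simps)
    have "?F w = t * (1 - t) * s\<^sup>2"
      unfolding weighted_sq_dist_def xw yw by algebra
    moreover have "0 < t * (1 - t)" using t False by auto
    ultimately have "s\<^sup>2 \<le> ?D\<^sup>2" using F_w by (metis mult_le_cancel_left_pos)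
    then have "s \<le> ?D" by (rule power2_le_imp_le) simp
    moreover have "?D \<le> s" unfolding s_def by (metis dist_triangle dist_commute)
    ultimately show ?thesis using that[of w] xw yw by simp
  qed
qed

text \<open>
  The point between \<open>x\<close> and \<open>y\<close> minimizes \<open>weighted_sq_dist t x y\<close>, so the variance inequality
  bounds \<open>(dist z p)\<^sup>2\<close>; replacing \<open>dist x y\<close> by the smaller \<open>\<bar>dist z x - dist z y\<bar>\<close> turns this
  bound into a perfect square.
\<close>

lemma dist_point_between_le:
  fixes x y z p :: "'a::hadamard_space"
  assumes t: "0 \<le> t" "t \<le> 1" and p: "dist x p = t * dist x y" "dist y p = (1 - t) * dist x y"
  shows "dist z p \<le> (1 - t) * dist z x + t * dist z y"
proof (rule power2_le_imp_le)
  have F_p: "weighted_sq_dist t x y p = t * (1 - t) * (dist x y)\<^sup>2"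
    by (rule weighted_sq_dist_eq[OF p])
  have min: "weighted_sq_dist t x y p \<le> weighted_sq_dist t x y q" for q
    using weighted_sq_dist_ge[OF t, of x y q] F_p
      zero_le_power2[of "(1 - t) * dist x q - t * dist y q"] by linarith
  have "\<bar>dist z x - dist z y\<bar> \<le> dist x y"
    by (metis abs_dist_diff_le dist_commute)
  then have "(dist z x - dist z y)\<^sup>2 \<le> (dist x y)\<^sup>2"
    using power_mono[of "\<bar>dist z x - dist z y\<bar>" "dist x y" 2] by simp
  then have "t * (1 - t) * (dist z x - dist z y)\<^sup>2 \<le> t * (1 - t) * (dist x y)\<^sup>2"
    using t by (intro mult_left_mono) auto
  moreover have "t * (1 - t) * (dist x y)\<^sup>2 + (dist z p)\<^sup>2 \<le>
      (1 - t) * (dist z x)\<^sup>2 + t * (dist z y)\<^sup>2"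
    using variance_inequality[OF strongly_midconvex_weighted_sq_dist[OF t] min, of z]
    unfolding F_p by (simp add: weighted_sq_dist_def dist_commute)
  moreover have "(1 - t) * (dist z x)\<^sup>2 + t * (dist z y)\<^sup>2 - t * (1 - t) * (dist z x - dist z y)\<^sup>2
      = ((1 - t) * dist z x + t * dist z y)\<^sup>2"
    by algebra
  ultimately show "(dist z p)\<^sup>2 \<le> ((1 - t) * dist z x + t * dist z y)\<^sup>2"
    by linarith
qed (use t in auto)

lemma point_between_unique:
  fixes x y p q :: "'a::hadamard_space"
  assumes "0 \<le> t" "t \<le> 1"
    and p: "dist x p = t * dist x y" "dist y p = (1 - t) * dist x y"
    and q: "dist x q \<le> t * dist x y" "dist y q \<le> (1 - t) * dist x y"
  shows "q = p"
proof -
  let ?F = "weighted_sq_dist t x y"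
  have F_p: "?F p = t * (1 - t) * (dist x y)\<^sup>2" by (rule weighted_sq_dist_eq[OF p])
  have min: "?F p \<le> ?F z" for z
    using weighted_sq_dist_ge[OF assms(1,2), of x y z] F_p
      zero_le_power2[of "(1 - t) * dist x z - t * dist y z"] by linarith
  have "?F q \<le> (1 - t) * (t * dist x y)\<^sup>2 + t * ((1 - t) * dist x y)\<^sup>2"
    unfolding weighted_sq_dist_def using assms by (intro add_mono mult_left_mono power_mono) auto
  also have "\<dots> = ?F p" unfolding F_p by algebra
  finally have "(dist p q)\<^sup>2 \<le> 0"
    using variance_inequality[OF strongly_midconvex_weighted_sq_dist[OF assms(1,2)] min, of q]
    by linarith
  then show ?thesis by simp
qed

lemma minimal_geodesic_point_between:
  assumes "minimal_geodesic g x y" "t \<in> {0..1}"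
  shows "dist x (g t) = t * dist x y" "dist y (g t) = (1 - t) * dist x y"
proof -
  have ends: "g 0 = x" "g 1 = y"
    and iso: "\<And>s t. s \<in> {0..1} \<Longrightarrow> t \<in> {0..1} \<Longrightarrow> dist (g s) (g t) = \<bar>t - s\<bar> * dist x y"
    using assms(1) unfolding minimal_geodesic_def by blast+
  show "dist x (g t) = t * dist x y" "dist y (g t) = (1 - t) * dist x y"
    using iso[of 0 t] iso[of 1 t] assms(2) unfolding ends by auto
qed

text \<open>
  Choosing the intermediate point for each parameter yields a geodesic:  for \<open>s < t\<close>, the point
  at the right ratio between \<open>x\<close> and \<open>g t\<close> is also the intermediate point of \<open>x\<close> and \<open>y\<close> at \<open>s\<close>,
  hence equals \<open>g s\<close>.
\<close>

lemma ex_minimal_geodesic: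
  fixes x y :: "'a::hadamard_space"
  obtains g where "minimal_geodesic g x y"
proof -
  have "\<exists>p. t \<in> {0..1} \<longrightarrow> dist x p = t * dist x y \<and> dist y p = (1 - t) * dist x y" for t
    by (metis ex_point_between[of t x y] atLeastAtMost_iff)
  then obtain g where g: "\<And>t. t \<in> {0..1} \<Longrightarrow> dist x (g t) = t * dist x y"
      "\<And>t. t \<in> {0..1} \<Longrightarrow> dist y (g t) = (1 - t) * dist x y"
    by metis
  have less: "dist (g s) (g t) = (t - s) * dist x y" if "0 \<le> s" "s < t" "t \<le> 1" for s t
  proof -
    have r: "0 \<le> s / t" "s / t \<le> 1" using that by auto
    obtain q where q: "dist x q = s / t * dist x (g t)" "dist (g t) q = (1 - s / t) * dist x (g t)"
      using ex_point_between[OF r] by blast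
    have xq: "dist x q = s * dist x y" and tq: "dist (g t) q = (t - s) * dist x y"
      using q g(1)[of t] that by (auto simp: left_diff_distrib)
    have "dist y q \<le> dist y (g t) + dist (g t) q" by (rule dist_triangle)
    also have "\<dots> = (1 - s) * dist x y"
      using g(2)[of t] tq that by (simp add: algebra_simps)
    finally have "q = g s"
      using point_between_unique[of s x "g s" y q] g[of s] xq that by auto
    then show ?thesis using tq by (simp add: dist_commute)
  qed
  have "dist (g s) (g t) = \<bar>t - s\<bar> * dist x y" if "s \<in> {0..1}" "t \<in> {0..1}" for s t
    using less[of s t] less[of t s] that by (auto simp: dist_commute abs_if not_less order_le_less)
  moreover have "g 0 = x" "g 1 = y" using g(1)[of 0] g(2)[of 1] by auto
  ultimately show thesis using that unfolding minimal_geodesic_def by blast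
qed

lemma geodesic_point_between:
  fixes x y :: "'a::hadamard_space"
  assumes t: "0 \<le> t" "t \<le> 1"
  shows "dist x (geodesic_point x t y) = t * dist x y"
    and "dist y (geodesic_point x t y) = (1 - t) * dist x y"
proof -
  obtain g where g: "minimal_geodesic g x y" by (rule ex_minimal_geodesic)
  have between: "dist x (h t) = t * dist x y" "dist y (h t) = (1 - t) * dist x y"
    if "minimal_geodesic h x y" for h
    using minimal_geodesic_point_between[OF that, of t] t by auto
  have "geodesic_point x t y = g t"
    unfolding geodesic_point_def
  proof (rule the_equality)
    show "\<exists>h. minimal_geodesic h x y \<and> g t = h t" using g by blast
  next
    fix z assume "\<exists>h. minimal_geodesic h x y \<and> z = h t"
    then show "z = g t"
      using point_between_unique[OF t between[OF g], of z] between by auto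
  qed
  then show "dist x (geodesic_point x t y) = t * dist x y"
    "dist y (geodesic_point x t y) = (1 - t) * dist x y"
    using between[OF g] by auto
qed

lemma geodesically_convex_dist:
  fixes l :: "'a::hadamard_space"
  shows "geodesically_convex (\<lambda>z. dist z l)"
  unfolding geodesically_convex_def
proof (intro allI impI convex_onI)
  fix g and x y :: 'a and t r s :: real
  assume g: "minimal_geodesic g x y" and t: "0 < t" "t < 1" and rs: "r \<in> {0..1}" "s \<in> {0..1}"
  define u where "u = (1 - t) *\<^sub>R r + t *\<^sub>R s"
  have u: "u \<in> {0..1}"
    unfolding u_def using convexD_alt[of "{0..1::real}" r s t] rs t by simp
  have "u - r = t * (s - r)" "u - s = (1 - t) * (r - s)"
    unfolding u_def by (auto simp: algebra_simps)
  then have param: "\<bar>u - r\<bar> = t * \<bar>s - r\<bar>" "\<bar>u - s\<bar> = (1 - t) * \<bar>s - r\<bar>"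
    using t by (simp_all add: abs_mult abs_minus_commute)
  have iso: "dist (g a) (g b) = \<bar>b - a\<bar> * dist x y" if "a \<in> {0..1}" "b \<in> {0..1}" for a b
    using g that unfolding minimal_geodesic_def by blast
  have "dist (g r) (g u) = t * dist (g r) (g s)" "dist (g s) (g u) = (1 - t) * dist (g r) (g s)"
    unfolding iso[OF rs] iso[OF rs(1) u] iso[OF rs(2) u] param by simp_all
  then show "((\<lambda>z. dist z l) \<circ> g) ((1 - t) *\<^sub>R r + t *\<^sub>R s) \<le>
      (1 - t) * ((\<lambda>z. dist z l) \<circ> g) r + t * ((\<lambda>z. dist z l) \<circ> g) s"
    using dist_point_between_le[of t "g r" "g u" "g s" l] t unfolding u_def
    by (simp add: dist_commute)
qed simp

section \<open>Distance from the means to a point\<close>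

definition mean_dist :: "(nat \<Rightarrow> 'a::metric_space) \<Rightarrow> 'a \<Rightarrow> nat \<Rightarrow> real" where
  "mean_dist x l n = 1 / real n * (\<Sum>k=1..n. dist (x k) l)"

definition mean_sq_dist :: "(nat \<Rightarrow> 'a::metric_space) \<Rightarrow> nat \<Rightarrow> 'a \<Rightarrow> real" where
  "mean_sq_dist x n z = 1 / real n * (\<Sum>k=1..n. (dist (x k) z)\<^sup>2)"

lemma strongly_midconvex_mean_sq_dist:
  fixes x :: "nat \<Rightarrow> 'a::hadamard_space"
  assumes "1 \<le> n"
  shows "strongly_midconvex (mean_sq_dist x n)"
  unfolding strongly_midconvex_def
proof (intro allI)
  fix p q :: 'a
  let ?d = "\<lambda>z k. (dist (x k) z)\<^sup>2"
  have "(\<Sum>k=1..n. ?d (hadamard_mid p q) k) \<le>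
      (\<Sum>k=1..n. 1/2 * ?d p k + 1/2 * ?d q k - 1/4 * (dist p q)\<^sup>2)"
    by (intro sum_mono hadamard_mid_inequality)
  also have "\<dots> = (\<Sum>k=1..n. ?d p k) / 2 + (\<Sum>k=1..n. ?d q k) / 2 - real n * ((dist p q)\<^sup>2 / 4)"
    by (simp add: sum.distrib sum_subtractf flip: sum_divide_distrib)
  finally show "mean_sq_dist x n (hadamard_mid p q) \<le>
      mean_sq_dist x n p / 2 + mean_sq_dist x n q / 2 - (dist p q)\<^sup>2 / 4"
    using assms unfolding mean_sq_dist_def by (simp add: field_simps)
qed

lemma barycenter_minimizes:
  fixes x :: "nat \<Rightarrow> 'a::hadamard_space"
  assumes n: "1 \<le> n"
  shows "mean_sq_dist x n (barycenter x n) \<le> mean_sq_dist x n z"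
proof -
  have "continuous_on UNIV (mean_sq_dist x n)"
    unfolding mean_sq_dist_def by (intro continuous_intros)
  moreover have "0 \<le> mean_sq_dist x n z" for z
    unfolding mean_sq_dist_def by (simp add: sum_nonneg)
  ultimately obtain w where w: "\<And>z. mean_sq_dist x n w \<le> mean_sq_dist x n z"
    using strongly_midconvex_ex_minimizer[OF strongly_midconvex_mean_sq_dist[OF n]] by blast
  have arg_min: "is_arg_min (mean_sq_dist x n) (\<lambda>z. z \<in> UNIV) b \<longleftrightarrow>
      (\<forall>z. mean_sq_dist x n b \<le> mean_sq_dist x n z)" for b
    by (auto simp: is_arg_min_linorder)
  have "barycenter x n = (THE b. is_arg_min (mean_sq_dist x n) (\<lambda>z. z \<in> UNIV) b)"
    unfolding barycenter_def mean_sq_dist_def ..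
  also have "\<dots> = w"
    unfolding arg_min
  proof (rule the_equality)
    fix b assume b: "\<forall>z. mean_sq_dist x n b \<le> mean_sq_dist x n z"
    have "(dist w b)\<^sup>2 \<le> 0"
      using variance_inequality[OF strongly_midconvex_mean_sq_dist[OF n] w, of b] b[rule_format, of w]
      by linarith
    then show "b = w" by simp
  qed (use w in blast)
  finally show ?thesis using w by simp
qed

text \<open>
  Averaging \<open>(dist b l)\<^sup>2 \<le> 2 * (dist (x k) b)\<^sup>2 + 2 * (dist (x k) l)\<^sup>2\<close> over \<open>k\<close> and using that \<open>b\<close>
  does at least as well as \<open>l\<close>.
\<close>

lemma dist_barycenter_le:
  fixes x :: "nat \<Rightarrow> 'a::hadamard_space"
  assumes n: "1 \<le> n"
  shows "(dist (barycenter x n) l)\<^sup>2 \<le> 4 * mean_sq_dist x n l"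
proof -
  let ?b = "barycenter x n"
  have "(dist ?b l)\<^sup>2 \<le> 2 * (dist (x k) ?b)\<^sup>2 + 2 * (dist (x k) l)\<^sup>2" for k
  proof -
    have "(dist ?b l)\<^sup>2 \<le> (dist (x k) ?b + dist (x k) l)\<^sup>2"
      by (intro power_mono) (auto simp: dist_triangle3)
    also have "\<dots> = 2 * (dist (x k) ?b)\<^sup>2 + 2 * (dist (x k) l)\<^sup>2 - (dist (x k) ?b - dist (x k) l)\<^sup>2"
      by algebra
    finally show ?thesis using zero_le_power2[of "dist (x k) ?b - dist (x k) l"] by linarith
  qed
  then have "(\<Sum>k=1..n. (dist ?b l)\<^sup>2) \<le> (\<Sum>k=1..n. 2 * (dist (x k) ?b)\<^sup>2 + 2 * (dist (x k) l)\<^sup>2)"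
    by (intro sum_mono)
  also have "\<dots> = 2 * (\<Sum>k=1..n. (dist (x k) ?b)\<^sup>2) + 2 * (\<Sum>k=1..n. (dist (x k) l)\<^sup>2)"
    by (simp add: sum.distrib sum_distrib_left)
  finally have "(dist ?b l)\<^sup>2 \<le> 2 * mean_sq_dist x n ?b + 2 * mean_sq_dist x n l"
    using n unfolding mean_sq_dist_def by (simp add: field_simps)
  then show ?thesis using barycenter_minimizes[OF n, of x l] by linarith
qed

text \<open>
  Multiplied by \<open>n\<close>, the convexity estimate for one step of the recursion becomes additive: the
  weights \<open>1 - 1/(n+1)\<close> and \<open>1/(n+1)\<close> turn into \<open>n\<close> and \<open>1\<close>.
\<close>

lemma dist_inductive_mean_le:
  fixes x :: "nat \<Rightarrow> 'a::hadamard_space"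
  assumes "1 \<le> n"
  shows "dist (inductive_mean x n) l \<le> mean_dist x l n"
proof -
  have "real n * dist (inductive_mean x n) l \<le> (\<Sum>k=1..n. dist (x k) l)"
    using assms
  proof (induction n rule: dec_induct)
    case base
    then show ?case by simp
  next
    case (step n)
    then obtain m where m: "n = Suc m" by (cases n) auto
    define t where "t = 1 / real (Suc n)"
    have t: "0 \<le> t" "t \<le> 1" and nt: "real (Suc n) * t = 1" "real (Suc n) * (1 - t) = real n"
      unfolding t_def by (auto simp: field_simps)
    let ?S = "inductive_mean x n" and ?y = "x (Suc n)"
    have "inductive_mean x (Suc n) = geodesic_point ?S t ?y"
      unfolding t_def m by simp
    then have "dist (inductive_mean x (Suc n)) l \<le> (1 - t) * dist ?S l + t * dist ?y l"
      using dist_point_between_le[OF t geodesic_point_between[OF t, where x = ?S and y = ?y], of l]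
      by (simp add: dist_commute)
    then have "real (Suc n) * dist (inductive_mean x (Suc n)) l \<le>
        real (Suc n) * ((1 - t) * dist ?S l + t * dist ?y l)"
      by (rule mult_left_mono) simp
    also have "\<dots> = real n * dist ?S l + dist ?y l"
      unfolding distrib_left mult.assoc[symmetric] nt by simp
    finally show ?case using step.IH by simp
  qed
  then show ?thesis using assms unfolding mean_dist_def by (simp add: field_simps)
qed

lemma dist_axiomatic_mean_le:
  fixes x :: "nat \<Rightarrow> 'a::hadamard_space"
  assumes \<beta>: "axiomatic_mean \<beta>" and n: "1 \<le> n"
  shows "dist (\<beta> (map x [1..<Suc n])) l \<le> mean_dist x l n"
proof -
  let ?xs = "map x [1..<Suc n]"
  have \<beta>_const: "\<beta> (replicate n l) = l"
    using \<beta> n unfolding axiomatic_mean_def by blast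
  have contract: "dist (\<beta> xs) (\<beta> ys) \<le> 1 / real n * (\<Sum>k<n. dist (xs ! k) (ys ! k))"
    if "length xs = n" "length ys = n" for xs ys
    using \<beta> n that unfolding axiomatic_mean_def by blast
  have "length ?xs = n" by simp
  then have "dist (\<beta> ?xs) l \<le> 1 / real n * (\<Sum>k<n. dist (?xs ! k) (replicate n l ! k))"
    using contract[of ?xs "replicate n l"] unfolding \<beta>_const by simp
  also have "(\<Sum>k<n. dist (?xs ! k) (replicate n l ! k)) = (\<Sum>k<n. dist (x (Suc k)) l)"
    by (intro sum.cong) (auto simp del: upt_Suc)
  also have "\<dots> = (\<Sum>k=1..n. dist (x k) l)"
    by (rule sum.reindex_bij_witness[of _ "\<lambda>k. k - 1" Suc]) auto
  finally show ?thesis unfolding mean_dist_def .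
qed

lemma expectation_drawn_uniformly:
  fixes f :: "'a::hadamard_space \<Rightarrow> real"
  assumes X: "drawn_uniformly M X x n" and n: "1 \<le> n" and f: "f \<in> borel_measurable borel"
  shows "(\<integral>\<omega>. f (X \<omega>) \<partial>M) = 1 / real n * (\<Sum>k=1..n. f (x k))"
proof -
  have "(\<integral>\<omega>. f (X \<omega>) \<partial>M) = (\<integral>z. f z \<partial>distr M borel X)"
    using X f unfolding drawn_uniformly_def by (subst integral_distr) auto
  also have "\<dots> = (\<integral>z. f z \<partial>distr (measure_pmf (pmf_of_set {1..n})) borel x)"
    using X unfolding drawn_uniformly_def by simp
  also have "\<dots> = (\<integral>k. f (x k) \<partial>measure_pmf (pmf_of_set {1..n}))"
    using f by (subst integral_distr) auto
  also have "\<dots> = 1 / real n * (\<Sum>k=1..n. f (x k))"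
    using n by (subst integral_pmf_of_set) auto
  finally show ?thesis .
qed

lemma dist_convex_mean_le:
  fixes x :: "nat \<Rightarrow> 'a::hadamard_space"
  assumes X: "drawn_uniformly M X x n" and c: "convex_mean M X c" and n: "1 \<le> n"
  shows "dist c l \<le> mean_dist x l n"
proof -
  have "\<bar>dist y l - dist z l\<bar> \<le> dist y z" for y z
    by (metis abs_dist_diff_le dist_commute)
  then have "1-lipschitz_on UNIV (\<lambda>z. dist z l)"
    by (intro lipschitz_onI) (auto simp: dist_real_def)
  then have "dist c l \<le> (\<integral>\<omega>. dist (X \<omega>) l \<partial>M)"
    using c geodesically_convex_dist[of l] unfolding convex_mean_def by blast
  also have "\<dots> = mean_dist x l n"
    unfolding mean_dist_def by (intro expectation_drawn_uniformly[OF X n] borel_measurable_continuous_onI continuous_intros)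
  finally show ?thesis .
qed

section \<open>Convergence of the means\<close>

lemma cesaro_tendsto_zero:
  fixes a :: "nat \<Rightarrow> real"
  assumes "a \<longlonglongrightarrow> 0"
  shows "(\<lambda>n. 1 / real n * (\<Sum>k=1..n. a k)) \<longlonglongrightarrow> 0"
proof (rule LIMSEQ_I)
  fix e :: real assume e: "0 < e"
  obtain N where N: "\<And>k. N \<le> k \<Longrightarrow> \<bar>a k\<bar> < e / 2"
    using LIMSEQ_D[OF assms, of "e / 2"] e by auto
  define C where "C = (\<Sum>k<N. \<bar>a k\<bar>)"
  have "(\<Sum>k=1..n. \<bar>a k\<bar>) \<le> C + real n * (e / 2)" for n
  proof -
    have "(\<Sum>k=1..n. \<bar>a k\<bar>) \<le> (\<Sum>k=1..n. (if k < N then \<bar>a k\<bar> else 0) + e / 2)"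
      using N e by (intro sum_mono) (auto simp: not_less intro: less_imp_le)
    also have "\<dots> = (\<Sum>k\<in>{k\<in>{1..n}. k < N}. \<bar>a k\<bar>) + real n * (e / 2)"
      unfolding sum.distrib by (subst sum.inter_filter) auto
    also have "(\<Sum>k\<in>{k\<in>{1..n}. k < N}. \<bar>a k\<bar>) \<le> C"
      unfolding C_def by (intro sum_mono2) auto
    finally show ?thesis by simp
  qed
  then have bound: "\<bar>\<Sum>k=1..n. a k\<bar> \<le> C + real n * (e / 2)" for n
    using sum_abs[of a "{1..n}"] order_trans by blast
  obtain K where K: "2 * C / e < real K" using reals_Archimedean2 by blast
  have "norm (1 / real n * (\<Sum>k=1..n. a k) - 0) < e" if "max 1 K \<le> n" for n
  proof -
    have n: "0 < real n" "real K \<le> real n" using that by auto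
    have "2 * C / e < real n" using K n(2) by linarith
    then have "2 * C < real n * e" using e by (simp add: field_simps)
    then have "\<bar>\<Sum>k=1..n. a k\<bar> < real n * e" using bound[of n] by linarith
    then show ?thesis using n by (simp add: abs_mult field_simps)
  qed
  then show "\<exists>K. \<forall>n\<ge>K. norm (1 / real n * (\<Sum>k=1..n. a k) - 0) < e" by blast
qed

theorem lemma2:
  fixes x :: "nat \<Rightarrow> 'a::hadamard_space" and l :: 'a
  assumes "x \<longlonglongrightarrow> l"
  shows "(\<lambda>n. barycenter x n) \<longlonglongrightarrow> l
    \<and> (\<lambda>n. inductive_mean x n) \<longlonglongrightarrow> l
    \<and> (\<forall>\<beta>. axiomatic_mean \<beta> \<longrightarrow> (\<lambda>n. \<beta> (map x [1..<Suc n])) \<longlonglongrightarrow> l)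
    \<and> (\<forall>(M :: nat \<Rightarrow> 'b measure) X c.
          (\<forall>n\<ge>1. drawn_uniformly (M n) (X n) x n \<and> convex_mean (M n) (X n) (c n))
          \<longrightarrow> c \<longlonglongrightarrow> l)"
proof -
  have dist_zero: "(\<lambda>k. dist (x k) l) \<longlonglongrightarrow> 0"
    using assms by (rule tendsto_dist_iff[THEN iffD1])
  have mean_dist: "mean_dist x l \<longlonglongrightarrow> 0"
    using cesaro_tendsto_zero[OF dist_zero] unfolding mean_dist_def .
  have converges: "m \<longlonglongrightarrow> l" if "\<And>n. 1 \<le> n \<Longrightarrow> dist (m n) l \<le> mean_dist x l n" for m
  proof -
    have "eventually (\<lambda>n. norm (dist (m n) l) \<le> mean_dist x l n) sequentially"
      using that by (intro eventually_sequentiallyI[of 1]) auto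
    then show ?thesis
      unfolding tendsto_dist_iff[of m] by (rule Lim_null_comparison) (rule mean_dist)
  qed
  have "(\<lambda>n. mean_sq_dist x n l) \<longlonglongrightarrow> 0"
    unfolding mean_sq_dist_def using tendsto_power[OF dist_zero, of 2]
    by (intro cesaro_tendsto_zero) simp
  then have "(\<lambda>n. 4 * mean_sq_dist x n l) \<longlonglongrightarrow> 0"
    by (rule tendsto_mult_right_zero)
  moreover have "eventually (\<lambda>n. norm ((dist (barycenter x n) l)\<^sup>2) \<le> 4 * mean_sq_dist x n l) sequentially"
    using dist_barycenter_le[of _ x l] by (intro eventually_sequentiallyI[of 1]) auto
  ultimately have "(\<lambda>n. (dist (barycenter x n) l)\<^sup>2) \<longlonglongrightarrow> 0"
    by (rule Lim_null_comparison[rotated])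
  then have "(\<lambda>n. barycenter x n) \<longlonglongrightarrow> l"
    unfolding tendsto_dist_iff[of "\<lambda>n. barycenter x n"] by simp
  moreover have "(\<lambda>n. inductive_mean x n) \<longlonglongrightarrow> l"
    by (intro converges dist_inductive_mean_le)
  moreover have "(\<lambda>n. \<beta> (map x [1..<Suc n])) \<longlonglongrightarrow> l" if "axiomatic_mean \<beta>" for \<beta>
    using that by (intro converges dist_axiomatic_mean_le)
  moreover have "c \<longlonglongrightarrow> l"
    if "\<forall>n\<ge>1. drawn_uniformly (M n) (X n) x n \<and> convex_mean (M n) (X n) (c n)"
    for M :: "nat \<Rightarrow> 'b measure" and X c
    using that by (intro converges dist_convex_mean_le) auto
  ultimately show ?thesis by blast
qed

end
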